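(* Let $k\geq 1$ be an integer. Every finite simple graph with at least one vertex and with minimum degree at least $3k-1$ has a $(k+1)$-connected subgraph on more than $2k$ vertices.
   Context: A graph is $(k+1)$-connected if it has more than $k+1$ vertices and remains connected after deleting any set of at most $k$ vertices. *)

theory Defs
  imports "Graph_Theory.Digraph_Component"
begin

text \<open>
  A finite simple graph is an instance of the locale \<^locale>\<open>graph\<close>: a finite, loop-free,
  symmetric digraph without parallel arcs. Each undirected edge is a pair of opposite arcs,
  so the degree of a vertex is its out-degree.
\<close>

text \<open>Meaningful only for finite graphs with at least one vertex.\<close>

definition min_degree :: "('a, 'b) pre_digraph \<Rightarrow> nat" where
  "min_degree G = Min (out_degree G ` verts G)"

text \<open>
  For finite graphs. With \<open>n = k + 1\<close>, the deleted sets \<open>S\<close> are those with at most \<open>k\<close> vertices.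
\<close>

definition n_connected :: "nat \<Rightarrow> ('a, 'b) pre_digraph \<Rightarrow> bool" where
  "n_connected n G \<longleftrightarrow>
     card (verts G) > n \<and>
     (\<forall>S. S \<subseteq> verts G \<and> card S < n \<longrightarrow> connected (G \<restriction> (verts G - S)))"

end

theory Submission
  imports Defs
begin

text \<open>
  Give every vertex of degree \<open>d\<close> the weight \<open>max (2k - d) (min k (3k - 1 - d))\<close>, with
  differences truncated at \<open>0\<close>, and call the sum of all weights the potential. It is
  \<open>0\<close> when the minimum degree is at least \<open>3k - 1\<close>. By induction on the number of
  vertices, a graph with more than \<open>2k\<close> vertices and potential less than \<open>2k\<^sup>2\<close>
  has the desired subgraph. If it is not itself \<open>(k+1)\<close>-connected, a set of at most
  \<open>k\<close> vertices splits it into two overlapping sides. If both sides have more than \<open>2k\<close>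
  vertices, the sum of their potentials exceeds that of the graph by at most \<open>2k\<close> per separating
  vertex, hence one side has potential less than \<open>2k\<^sup>2\<close>. If just one side is that large,
  delete the rest of the other: each deleted vertex had weight at least \<open>k\<close>, and its deletion
  increases the weight of each of the at most \<open>k\<close> separating vertices by at most \<open>1\<close>.
  If no side is that large, the potential is at least \<open>2k\<^sup>2\<close>.
\<close>

section \<open>Degrees, weights and separations\<close>

definition nbr_count :: "'a rel \<Rightarrow> 'a set \<Rightarrow> 'a \<Rightarrow> nat" where
  "nbr_count R A v = card (R `` {v} \<inter> A)"

text \<open>For \<open>k \<ge> 1\<close> the weight falls with slope -1 from \<open>2 * k\<close> at
  degree 0 to \<open>k\<close> at degree \<open>k\<close>, stays at \<open>k\<close> up to degree
  \<open>2 * k - 1\<close>, then falls with slope -1 to 0 at \<open>3 * k - 1\<close>.\<close>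

definition weight :: "nat \<Rightarrow> nat \<Rightarrow> nat" where
  "weight k d = max (2 * k - d) (min k (3 * k - 1 - d))"

text \<open>Only induced subgraphs occur, so each is given by its vertex set \<open>A\<close> within
  one fixed adjacency relation \<open>R\<close>.\<close>

definition potential :: "nat \<Rightarrow> 'a rel \<Rightarrow> 'a set \<Rightarrow> nat" where
  "potential k R A = (\<Sum>v\<in>A. weight k (nbr_count R A v))"

definition separates :: "'a rel \<Rightarrow> 'a set \<Rightarrow> 'a set \<Rightarrow> 'a set \<Rightarrow> bool" where
  "separates R P S Q \<longleftrightarrow>
     P \<inter> S = {} \<and> P \<inter> Q = {} \<and> S \<inter> Q = {} \<and> P \<noteq> {} \<and> Q \<noteq> {} \<and> R \<inter> (P \<times> Q \<union> Q \<times> P) = {}"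

lemma weight_lipschitz: "b \<le> a + m \<Longrightarrow> weight k a \<le> weight k b + m"
  unfolding weight_def by (auto simp: max_def min_def)

text \<open>If \<open>a\<close> and \<open>b\<close> are both at least \<open>k\<close>, both
  weights are at most \<open>k\<close>. If, say, \<open>a < k\<close>, then \<open>a\<close> has
  weight \<open>2 * k - a\<close>, and by \<open>weight_lipschitz\<close> the weight of
  \<open>b\<close> exceeds that of \<open>c\<close> by at most \<open>a\<close>.\<close>

lemma weight_add:
  assumes "k \<ge> 1" and "c \<le> a + b"
  shows "weight k a + weight k b \<le> 2 * k + weight k c"
  using assms unfolding weight_def by (auto simp: max_def min_def)

lemma weight_ge: "d < 2 * k \<Longrightarrow> k \<le> weight k d"
  unfolding weight_def by (auto simp: max_def min_def)

text \<open>Used with \<open>n\<close> the number of vertices: \<open>d \<le> n - 1\<close> gives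
  \<open>3 * k - 1 - d \<ge> 3 * k - n\<close>, and \<open>2 * k \<le> n\<close> keeps
  \<open>3 * k - n\<close> within the cap \<open>k\<close>.\<close>

lemma weight_ge_codegree: "d < n \<Longrightarrow> 2 * k \<le> n \<Longrightarrow> 3 * k - n \<le> weight k d"
  unfolding weight_def by (auto simp: max_def min_def)

lemma nbr_count_Un: "nbr_count R (A \<union> B) v \<le> nbr_count R A v + nbr_count R B v"
  unfolding nbr_count_def by (metis Int_Un_distrib card_Un_le)

lemma nbr_count_le: "finite A \<Longrightarrow> nbr_count R A v \<le> card A"
  unfolding nbr_count_def by (simp add: card_mono)

lemma nbr_count_less:
  assumes "finite A" and "v \<in> A" and "irrefl R"
  shows "nbr_count R A v < card A"
proof -
  have "R `` {v} \<inter> A \<subset> A" using assms by (auto simp: irrefl_def)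
  then show ?thesis using assms(1) by (simp add: nbr_count_def psubset_card_mono)
qed

section \<open>The potential under a separation\<close>

lemma separates_sym: "separates R P S Q \<Longrightarrow> separates R Q S P"
  unfolding separates_def by auto

lemma nbr_count_side:
  assumes "separates R P S Q" and "v \<in> P"
  shows "nbr_count R (P \<union> S \<union> Q) v = nbr_count R (P \<union> S) v"
proof -
  have "R `` {v} \<inter> (P \<union> S \<union> Q) = R `` {v} \<inter> (P \<union> S)"
    using assms unfolding separates_def by auto
  then show ?thesis by (simp add: nbr_count_def)
qed

text \<open>No vertex of \<open>P\<close> has a neighbour in \<open>Q\<close> or conversely, so
  passing to a side alters only the weights on \<open>S\<close>.\<close>

lemma potential_split:
  assumes sep: "separates R P S Q" and fin: "finite P" "finite S" "finite Q"
  shows "potential k R (P \<union> S \<union> Q) =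
    (\<Sum>v\<in>P. weight k (nbr_count R (P \<union> S) v)) + (\<Sum>v\<in>S. weight k (nbr_count R (P \<union> S \<union> Q) v))
    + (\<Sum>v\<in>Q. weight k (nbr_count R (Q \<union> S) v))"
proof -
  have "potential k R (P \<union> S \<union> Q) =
      (\<Sum>v\<in>P. weight k (nbr_count R (P \<union> S \<union> Q) v)) + (\<Sum>v\<in>S. weight k (nbr_count R (P \<union> S \<union> Q) v))
      + (\<Sum>v\<in>Q. weight k (nbr_count R (P \<union> S \<union> Q) v))"
    unfolding potential_def using sep fin
    by (simp add: separates_def sum.union_disjoint Int_Un_distrib2)
  moreover have "nbr_count R (P \<union> S \<union> Q) v = nbr_count R (Q \<union> S) v" if "v \<in> Q" for v
    using nbr_count_side[OF separates_sym[OF sep] that] by (simp add: Un_ac)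
  ultimately show ?thesis using nbr_count_side[OF sep] by simp
qed

lemma potential_side:
  assumes "separates R P S Q" and "finite P" "finite S"
  shows "potential k R (P \<union> S) =
    (\<Sum>v\<in>P. weight k (nbr_count R (P \<union> S) v)) + (\<Sum>v\<in>S. weight k (nbr_count R (P \<union> S) v))"
  unfolding potential_def using assms by (subst sum.union_disjoint) (auto simp: separates_def)

lemma potential_large_sides:
  assumes k: "k \<ge> 1" and sep: "separates R P S Q" and fin: "finite P" "finite S" "finite Q"
  shows "potential k R (P \<union> S) + potential k R (Q \<union> S) \<le> potential k R (P \<union> S \<union> Q) + 2 * k * card S"
proof -
  have "weight k (nbr_count R (P \<union> S) v) + weight k (nbr_count R (Q \<union> S) v)
      \<le> 2 * k + weight k (nbr_count R (P \<union> S \<union> Q) v)" for v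
  proof (rule weight_add[OF k])
    show "nbr_count R (P \<union> S \<union> Q) v \<le> nbr_count R (P \<union> S) v + nbr_count R (Q \<union> S) v"
      using nbr_count_Un[where A = "P \<union> S" and B = "Q \<union> S" and R = R and v = v] fin
      by (simp add: Un_ac)
  qed
  then have "(\<Sum>v\<in>S. weight k (nbr_count R (P \<union> S) v) + weight k (nbr_count R (Q \<union> S) v))
      \<le> (\<Sum>v\<in>S. 2 * k + weight k (nbr_count R (P \<union> S \<union> Q) v))"
    by (intro sum_mono)
  then show ?thesis
    using potential_split[OF sep fin] potential_side[OF sep fin(1,2)]
      potential_side[OF separates_sym[OF sep] fin(3,2)]
    by (simp add: sum.distrib mult.commute)
qed

lemma potential_small_side:
  assumes sep: "separates R P S Q" and fin: "finite P" "finite S" "finite Q"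
    and irr: "irrefl R" and small: "card (P \<union> S) \<le> 2 * k" and S: "card S \<le> k"
  shows "potential k R (Q \<union> S) \<le> potential k R (P \<union> S \<union> Q)"
proof -
  \<comment> \<open>Without loops, degrees inside \<open>P \<union> S\<close> are at most
    \<open>2 * k - 1\<close>, the right end of the plateau of the weight.\<close>
  have "k \<le> weight k (nbr_count R (P \<union> S) v)" if "v \<in> P" for v
    using nbr_count_less[of "P \<union> S" v R] that fin irr small by (intro weight_ge) auto
  then have "card P * k \<le> (\<Sum>v\<in>P. weight k (nbr_count R (P \<union> S) v))"
    using sum_bounded_below[of P k "\<lambda>v. weight k (nbr_count R (P \<union> S) v)"] by simp
  moreover have "weight k (nbr_count R (Q \<union> S) v) \<le> weight k (nbr_count R (P \<union> S \<union> Q) v) + card P" for v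
  proof (rule weight_lipschitz)
    show "nbr_count R (P \<union> S \<union> Q) v \<le> nbr_count R (Q \<union> S) v + card P"
      using nbr_count_Un[where A = "Q \<union> S" and B = P and R = R and v = v]
        nbr_count_le[of P R v] fin
      by (simp add: Un_ac)
  qed
  then have "(\<Sum>v\<in>S. weight k (nbr_count R (Q \<union> S) v))
      \<le> (\<Sum>v\<in>S. weight k (nbr_count R (P \<union> S \<union> Q) v)) + card S * card P"
    using sum_mono[of S _ "\<lambda>v. weight k (nbr_count R (P \<union> S \<union> Q) v) + card P"]
    by (simp add: sum.distrib)
  moreover have "card S * card P \<le> card P * k"
    using mult_le_mono2[OF S] by (simp add: mult.commute)
  ultimately show ?thesis
    using potential_split[OF sep fin, of k] potential_side[OF separates_sym[OF sep] fin(3,2), of k]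
    by linarith
qed

text \<open>Vertices outside \<open>S\<close> weigh at least \<open>k\<close> each, so
  \<open>2 * k\<close> of them suffice. With fewer, there are fewer than \<open>3 * k\<close>
  vertices in all, and the low degrees this forces on \<open>S\<close> make up the
  shortfall.\<close>

lemma potential_two_small_sides:
  assumes sep: "separates R P S Q" and fin: "finite P" "finite S" "finite Q"
    and irr: "irrefl R" and small: "card (P \<union> S) \<le> 2 * k" "card (Q \<union> S) \<le> 2 * k"
    and S: "card S \<le> k" and n: "2 * k < card (P \<union> S \<union> Q)"
  shows "2 * k * k \<le> potential k R (P \<union> S \<union> Q)"
proof -
  let ?n = "card (P \<union> S \<union> Q)"
  have card: "?n = card P + card S + card Q"
    using sep fin by (simp add: separates_def card_Un_disjoint Int_Un_distrib2)
  have side: "k \<le> weight k (nbr_count R (X \<union> S) v)"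
    if "v \<in> X" "finite X" "card (X \<union> S) \<le> 2 * k" for X v
    using nbr_count_less[of "X \<union> S" v R] that fin irr by (intro weight_ge) auto
  have "(\<Sum>v\<in>P. k) \<le> (\<Sum>v\<in>P. weight k (nbr_count R (P \<union> S) v))"
    and "(\<Sum>v\<in>Q. k) \<le> (\<Sum>v\<in>Q. weight k (nbr_count R (Q \<union> S) v))"
    using side fin small by (intro sum_mono; blast)+
  moreover have "(\<Sum>v\<in>S. 3 * k - ?n) \<le> (\<Sum>v\<in>S. weight k (nbr_count R (P \<union> S \<union> Q) v))"
    using fin irr n by (intro sum_mono weight_ge_codegree nbr_count_less) auto
  ultimately have "card P * k + card S * (3 * k - ?n) + card Q * k \<le> potential k R (P \<union> S \<union> Q)"
    using potential_split[OF sep fin, of k] by simp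
  moreover have "2 * k * k \<le> card P * k + card S * (3 * k - ?n) + card Q * k"
  proof (cases "?n \<ge> 3 * k")
    case True
    then have "2 * k \<le> card P + card Q" using S card by linarith
    then have "2 * k * k \<le> (card P + card Q) * k" by (rule mult_le_mono1)
    then show ?thesis by (simp add: algebra_simps)
  next
    case False
    \<comment> \<open>Slack variables avoid truncated subtraction: \<open>m = 3 * k - ?n\<close>,
      \<open>s = k - card S\<close>, \<open>t = ?n - 2 * k\<close>. The lower bound then equals
      \<open>2 * k * k + s * t\<close>.\<close>
    obtain m where m: "3 * k = ?n + m" using False by (metis le_add_diff_inverse nat_le_linear)
    obtain s where s: "k = card S + s" using S by (metis le_add_diff_inverse)
    have "m \<le> k" using m n by linarith
    then obtain t where t: "k = m + t" using le_Suc_ex by blast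
    have pq: "card P + card Q = k + t + s" using m s t card by linarith
    have "card P * k + card S * m + card Q * k = (card P + card Q) * k + card S * m"
      by (simp add: algebra_simps)
    also have "\<dots> = k * k + (t + s) * k + card S * m"
      unfolding pq by (simp add: algebra_simps)
    also have "\<dots> = 2 * k * k + s * t"
    proof -
      have "k * k = (card S + s) * (m + t)" and "(t + s) * k = t * (card S + s) + s * (m + t)"
        by (simp_all only: s[symmetric] t[symmetric] distrib_right)
      then show ?thesis by (simp add: algebra_simps)
    qed
    finally show ?thesis using m by simp
  qed
  ultimately show ?thesis by linarith
qed

section \<open>Induction to a vertex set without small separators\<close>

lemma ex_unseparated_subset:
  assumes k: "k \<ge> 1" and irr: "irrefl R"
  shows "finite A \<Longrightarrow> 2 * k < card A \<Longrightarrow> potential k R A < 2 * k * k \<Longrightarrow>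
    \<exists>B\<subseteq>A. 2 * k < card B \<and> (\<nexists>P S Q. B = P \<union> S \<union> Q \<and> separates R P S Q \<and> card S \<le> k)"
proof (induction "card A" arbitrary: A rule: less_induct)
  case less
  show ?case
  proof (cases "\<exists>P S Q. A = P \<union> S \<union> Q \<and> separates R P S Q \<and> card S \<le> k")
    case False
    then show ?thesis using less.prems by blast
  next
    case True
    then obtain P S Q where A: "A = P \<union> S \<union> Q" and sep: "separates R P S Q" and S: "card S \<le> k"
      by blast
    have fin: "finite P" "finite S" "finite Q" using less.prems A by auto
    have "P \<union> S \<subset> A" "Q \<union> S \<subset> A" using sep A unfolding separates_def by blast+
    note sub = this psubset_card_mono[OF less.prems(1) this(1)] psubset_card_mono[OF less.prems(1) this(2)]
    have sides: "2 * k < card (X \<union> S) \<and> potential k R (X \<union> S) < 2 * k * k \<Longrightarrow> ?thesis"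
      if "X = P \<or> X = Q" for X
      using that less.hyps[of "X \<union> S"] sub fin by (meson finite_UnI order.trans psubset_imp_subset)
    consider "card (P \<union> S) \<le> 2 * k" "card (Q \<union> S) \<le> 2 * k"
      | "card (P \<union> S) \<le> 2 * k" "2 * k < card (Q \<union> S)"
      | "2 * k < card (P \<union> S)" "card (Q \<union> S) \<le> 2 * k"
      | "2 * k < card (P \<union> S)" "2 * k < card (Q \<union> S)"
      by linarith
    then show ?thesis
    proof cases
      case 1
      then show ?thesis
        using potential_two_small_sides[OF sep fin irr 1 S] less.prems A by simp
    next
      case 2
      then show ?thesis
        using sides[of Q] potential_small_side[OF sep fin irr 2(1) S] less.prems A by simp
    next
      case 3
      have "Q \<union> S \<union> P = A" using A by blast
      then show ?thesis
        using sides[of P] potential_small_side[OF separates_sym[OF sep] fin(3,2,1) irr 3(2) S] 3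
          less.prems by simp
    next
      case 4
      \<comment> \<open>Hence the potentials of the two sides sum to less than
        \<open>4 * k * k\<close>.\<close>
      have "2 * k * card S \<le> 2 * k * k" using S by simp
      then have "potential k R (P \<union> S) < 2 * k * k \<or> potential k R (Q \<union> S) < 2 * k * k"
        using potential_large_sides[OF k sep fin, folded A] less.prems(3) by linarith
      then show ?thesis using sides 4 by blast
    qed
  qed
qed

section \<open>Transfer to digraphs\<close>

lemma (in graph) graph_induce_subgraph:
  assumes "A \<subseteq> verts G"
  shows "graph (G \<restriction> A)"
proof -
  interpret H: wf_digraph "G \<restriction> A" by (rule wellformed_induce_subgraph)
  show ?thesis
  proof unfold_locales
    show "finite (verts (G \<restriction> A))" using assms by (simp add: finite_subset)
    show "symmetric (G \<restriction> A)" using sym_arcs unfolding symmetric_conv by auto metis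
  qed (auto dest: no_loops no_multi_arcs)
qed

text \<open>Without parallel arcs, distinct arcs leaving \<open>v\<close> have distinct
  heads.\<close>

lemma (in graph) out_degree_eq_nbr_count:
  "out_degree G v = nbr_count (arcs_ends G) (verts G) v"
proof -
  have "arcs_ends G `` {v} \<inter> verts G = head G ` out_arcs G v"
    by (auto simp: arcs_ends_conv out_arcs_def)
  moreover have "inj_on (head G) (out_arcs G v)"
    by (auto simp: inj_on_def out_arcs_def arc_to_ends_def intro: no_multi_arcs)
  ultimately show ?thesis by (simp add: nbr_count_def out_degree_def card_image)
qed

lemma (in graph) separates_if_not_connected:
  assumes "B \<subseteq> verts G" and "B \<noteq> {}" and "\<not> connected (G \<restriction> B)"
  obtains P Q where "B = P \<union> Q" and "separates (arcs_ends G) P {} Q"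
proof -
  interpret H: graph "G \<restriction> B" by (rule graph_induce_subgraph[OF assms(1)])
  \<comment> \<open>\<open>connected\<close> refers to the symmetric closure and demands a nonempty
    vertex set; as arcs come in opposite pairs, plain reachability decides it.\<close>
  obtain u v where uv: "u \<in> B" "v \<in> B" "\<not> u \<rightarrow>\<^sup>*\<^bsub>G \<restriction> B\<^esub> v"
    using assms(2,3) H.reachable_mk_symmetric_eq[OF H.sym_arcs]
    unfolding connected_def strongly_connected_def by auto
  \<comment> \<open>The component of \<open>u\<close>: no arc leaves it within \<open>B\<close>, and
    by symmetry none enters it.\<close>
  define P where "P = {w \<in> B. u \<rightarrow>\<^sup>*\<^bsub>G \<restriction> B\<^esub> w}"
  have "(x, y) \<notin> arcs_ends G" if "x \<in> P" "y \<in> B - P" for x y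
  proof
    assume "(x, y) \<in> arcs_ends G"
    then have "x \<rightarrow>\<^bsub>G \<restriction> B\<^esub> y" using that by (auto simp: P_def arcs_ends_conv)
    then show False using that H.reachable_adj_trans by (auto simp: P_def)
  qed
  moreover have "(y, x) \<notin> arcs_ends G" if "x \<in> P" "y \<in> B - P" for x y
    using calculation[OF that] graph_symmetric by blast
  moreover have "u \<in> P" "v \<in> B - P" using uv by (auto simp: P_def)
  ultimately have "separates (arcs_ends G) P {} (B - P)" unfolding separates_def by blast
  moreover have "B = P \<union> (B - P)" by (auto simp: P_def)
  ultimately show ?thesis using that by blast
qed

lemma (in graph) n_connected_induce_subgraph:
  assumes A: "A \<subseteq> verts G" and n: "n < card A"
    and unsep: "\<nexists>P S Q. A = P \<union> S \<union> Q \<and> separates (arcs_ends G) P S Q \<and> card S < n"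
  shows "n_connected n (G \<restriction> A)"
  unfolding n_connected_def
proof (intro conjI allI impI)
  show "n < card (verts (G \<restriction> A))" using n by simp
next
  fix S assume "S \<subseteq> verts (G \<restriction> A) \<and> card S < n"
  then have S: "S \<subseteq> A" "card S < n" by auto
  have eq: "(G \<restriction> A) \<restriction> (A - S) = G \<restriction> (A - S)" by (auto simp: induce_subgraph_def)
  have "A - S \<noteq> {}" using S n by auto
  moreover have "A - S \<subseteq> verts G" using A by blast
  \<comment> \<open>Putting \<open>S\<close> back turns a split of \<open>A - S\<close> with empty
    separator into one of \<open>A\<close> with separator \<open>S\<close>.\<close>
  moreover have False if "A - S = P \<union> Q" "separates (arcs_ends G) P {} Q" for P Q
  proof -
    have "A = P \<union> S \<union> Q" using that(1) S(1) by blast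
    moreover have "separates (arcs_ends G) P S Q"
      using that unfolding separates_def by blast
    ultimately show False using unsep S(2) by blast
  qed
  ultimately show "connected ((G \<restriction> A) \<restriction> (verts (G \<restriction> A) - S))"
    using separates_if_not_connected[of "A - S"] eq by auto
qed

theorem theorem1:
  fixes G :: "('a, 'b) pre_digraph" and k :: nat
  assumes "k \<ge> 1"
    and "graph G"
    and "verts G \<noteq> {}"
    and "min_degree G \<ge> 3 * k - 1"
  shows "\<exists>H. subgraph H G \<and> graph H \<and> n_connected (k + 1) H \<and> card (verts H) > 2 * k"
proof -
  interpret graph G by fact
  let ?R = "arcs_ends G"
  have irr: "irrefl ?R" using adj_not_same by (auto simp: irrefl_def)
  have deg: "3 * k - 1 \<le> nbr_count ?R (verts G) v" if "v \<in> verts G" for v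
    using assms(4) that unfolding min_degree_def
    by (auto simp flip: out_degree_eq_nbr_count intro: order.trans Min_le)
  obtain v where v: "v \<in> verts G" using assms(3) by blast
  have "2 * k < card (verts G)"
    using deg[OF v] nbr_count_less[OF finite_verts v irr] assms(1) by linarith
  \<comment> \<open>Since \<open>3 * k - 1 \<ge> 2 * k\<close> for \<open>k \<ge> 1\<close>, both
    differences in the weight vanish.\<close>
  moreover have "potential k ?R (verts G) = 0"
    unfolding potential_def weight_def using deg assms(1) by (force simp: max_def min_def)
  ultimately obtain B where B: "B \<subseteq> verts G" "2 * k < card B"
      "\<nexists>P S Q. B = P \<union> S \<union> Q \<and> separates ?R P S Q \<and> card S \<le> k"
    using ex_unseparated_subset[OF assms(1) irr finite_verts] assms(1) by auto
  \<comment> \<open>The size condition holds because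
    \<open>k + 1 \<le> 2 * k < card B\<close>.\<close>
  have "n_connected (k + 1) (G \<restriction> B)"
    using B assms(1) by (intro n_connected_induce_subgraph) (auto simp: less_Suc_eq_le)
  then show ?thesis
    using B subgraph_induce_subgraphI graph_induce_subgraph by (intro exI[of _ "G \<restriction> B"]) simp
qed

end
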